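(* Let $d,m,n\in\mathbb{N}$ with $0\le d<\min\{m,n\}$. Let $A,B$ be distinct indeterminates over $\mathbb{Q}$ and let $$Q_d^{(-n,-m)}(A,B,x):=\frac{s_d(A,B)}{p_d(A,B)}\cdot P_d^{(-n,-m)}\!\left(\frac{(x-A)+(x-B)}{B-A}\right),$$ where $P_d^{(-n,-m)}$ is the Jacobi polynomial, so that $$P_d^{(-n,-m)}\!\left(\frac{(x-A)+(x-B)}{B-A}\right)=\sum_{j=0}^d\binom{n-d+j-1}{j}\binom{m-j-1}{d-j}\frac{(x-A)^j(x-B)^{d-j}}{(A-B)^d},$$ $p_d(A,B)=\frac{1}{(A-B)^d}\binom{m+n-d-1}{d}$ is its coefficient of $x^d$, and $$s_d(A,B)=(A-B)^{(m-d)(n-d)}\prod_{i=1}^{d}\frac{(i-1)!\,(m+n-d-i)!}{(m-i)!\,(n-i)!}.$$ Then $Q_d^{(-n,-m)}(A,B,x)\in\mathbb{Z}[x-A,x-B]$, and for every field $\mathbb{K}$ and all $\alpha,\beta\in\mathbb{K}$ with $\alpha\neq\beta$, $$\operatorname{Sres}_d((x-\alpha)^m,(x-\beta)^n)=Q_d^{(-n,-m)}(\alpha,\beta,x)\quad\text{in }\mathbb{K}[x],$$ where $Q_d^{(-n,-m)}(\alpha,\beta,x)$ denotes the image of $Q_d^{(-n,-m)}(A,B,x)$ under the ring homomorphism $\mathbb{Z}[A,B,x]\to\mathbb{K}[x]$ with $1\mapsto 1_{\mathbb{K}}$, $A\mapsto\alpha$, $B\mapsto\beta$, $x\mapsto 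x$.
   Context: Subresultants. Let $f=f_mx^m+\cdots+f_0$ and $g=g_nx^n+\cdots+g_0$ in $\mathbb{K}[x]$ with $f_m\ne0$, $g_n\neq0$, and set $f_\ell=0$ for $\ell<0$ or $\ell>m$, and $g_\ell=0$ for $\ell<0$ or $\ell>n$. For $0\le d<\min\{m,n\}$, the order-$d$ subresultant $\operatorname{Sres}_d(f,g)\in\mathbb{K}[x]$ is the determinant of the square matrix of size $m+n-2d$ whose row $i$, for $1\le i\le n-d$, has entry $f_{m+i-j}$ in column $j$ for $1\le j\le m+n-2d-1$ and entry $x^{n-d-i}f$ in the last column, and whose row $n-d+i$, for $1\le i\le m-d$, has entry $g_{n+i-j}$ in column $j$ for $1\le j\le m+n-2d-1$ and entry $x^{m-d-i}g$ in the last column. Jacobi polynomials. For integers $k,\ell,r$ with $r\ge0$, $$P_r^{(k,\ell)}(z)=\sum_{j=0}^r\frac{(k+r-j+1)_j}{j!}\,\frac{(\ell+j+1)_{r-j}}{(r-j)!}\left(\frac{z-1}{2}\right)^{r-j}\left(\frac{z+1}{2}\right)^j\in\mathbb{Q}[z],$$ where $(a)_0=1$ and $(a)_j=a(a+1)\cdots(a+j-1)$ for $j\ge1$. Empty products equal $1$. *)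

theory Defs
  imports Subresultants.Subresultant
begin

text \<open>
  \<open>Sres\<^sub>d(f,g)\<close> is \<^const>\<open>subresultant\<close>. The matrix in its definition is the transpose of the
  row-wise matrix \<open>sres_mat d f g\<close>, whose rows are formed from shifts of \<open>f\<close> and then of \<open>g\<close>.
  Rows and columns of \<open>sres_mat\<close> are indexed from 0, hence the exponents \<open>n - d - 1 - i\<close>
  and \<open>m - d - 1 - i'\<close> in the last column.
\<close>

definition sres_mat :: "nat \<Rightarrow> 'a::comm_ring_1 poly \<Rightarrow> 'a poly \<Rightarrow> 'a poly mat" where
  "sres_mat d f g = (let m = degree f; n = degree g; N = (m - d) + (n - d) in
     mat N N (\<lambda>(i, j).
       if i < n - d then
         if j = N - 1 then monom 1 (n - d - 1 - i) * f
         else [:coeff_int f (int m + int i - int j):]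
       else let i' = i - (n - d) in
         if j = N - 1 then monom 1 (m - d - 1 - i') * g
         else [:coeff_int g (int n + int i' - int j):]))"

lemma subresultant_eq_det_sres_mat: "subresultant d f g = det (sres_mat d f g)"
proof -
  let ?N = "(degree f - d) + (degree g - d)"
  have carrier: "subresultant_mat d f g \<in> carrier_mat ?N ?N"
    by (rule carrier_matI) (rule subresultant_mat_dim)+
  have swap: "(a - b) + c = (a + c) - b" for a b c :: int
    by (rule diff_add_eq)
  have entry: "sres_mat d f g $$ (i, j) = subresultant_mat d f g $$ (j, i)"
    if "i < ?N" "j < ?N" for i j
    unfolding sres_mat_def subresultant_mat_def Let_def swap
      index_mat(1)[OF that] index_mat(1)[OF that(2) that(1)] prod.case ..
  have "sres_mat d f g = transpose_mat (subresultant_mat d f g)"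
  proof (rule eq_matI)
    fix i j
    assume "i < dim_row (transpose_mat (subresultant_mat d f g))"
      and "j < dim_col (transpose_mat (subresultant_mat d f g))"
    then have "i < ?N" "j < ?N"
      unfolding index_transpose_mat subresultant_mat_dim .
    then show "sres_mat d f g $$ (i, j) = transpose_mat (subresultant_mat d f g) $$ (i, j)"
      using entry index_transpose_mat(1)[of i "subresultant_mat d f g" j]
      unfolding subresultant_mat_dim by metis
  qed (simp_all only: sres_mat_def Let_def dim_row_mat dim_col_mat index_transpose_mat
         subresultant_mat_dim)
  then show ?thesis
    unfolding subresultant_def by (metis det_transpose carrier)
qed


definition jacobi_poly :: "int \<Rightarrow> int \<Rightarrow> nat \<Rightarrow> rat poly" where
  "jacobi_poly k l r = (\<Sum>j\<le>r.
     smult (pochhammer (of_int (k + int r - int j + 1)) j / fact j *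
            (pochhammer (of_int (l + int j + 1)) (r - j) / fact (r - j)))
       ([:- 1 / 2, 1 / 2:] ^ (r - j) * [:1 / 2, 1 / 2:] ^ j))"


text \<open>
  \<open>\<int>[A,B]\<close> is \<^typ>\<open>int poly poly\<close> and \<open>\<rat>(A,B)\<close> is \<^typ>\<open>rat poly poly fract\<close>,
  where in both cases \<open>A\<close> is the inner and \<open>B\<close> the outer variable.
\<close>

definition ind_A :: "rat poly poly fract" where
  "ind_A = to_fract [:[:0, 1:]:]"

definition ind_B :: "rat poly poly fract" where
  "ind_B = to_fract [:0, 1:]"

definition const_frac :: "rat \<Rightarrow> rat poly poly fract" where
  "const_frac c = to_fract [:[:c:]:]"

text \<open>
  The unique ring homomorphism \<open>\<int>[A,B] \<rightarrow> R\<close> with \<open>A \<mapsto> a\<close> and \<open>B \<mapsto> b\<close>.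
\<close>

definition eval2 :: "'a::comm_ring_1 \<Rightarrow> 'a \<Rightarrow> int poly poly \<Rightarrow> 'a" where
  "eval2 a b h = poly (map_poly (\<lambda>p. poly (map_poly of_int p) a) h) b"

text \<open>
  \<open>\<int>[A,B,x]\<close> is \<^typ>\<open>int poly poly poly\<close>, with \<open>x\<close> as outermost variable. The induced ring
  homomorphism \<open>\<int>[A,B,x] \<rightarrow> R[x]\<close> with \<open>A \<mapsto> a\<close>, \<open>B \<mapsto> b\<close>, \<open>x \<mapsto> x\<close>; for \<open>a = ind_A\<close> and
  \<open>b = ind_B\<close> it is the inclusion of \<open>\<int>[A,B,x]\<close> in \<open>\<rat>(A,B)[x]\<close>.
\<close>

definition specialize :: "'a::comm_ring_1 \<Rightarrow> 'a \<Rightarrow> int poly poly poly \<Rightarrow> 'a poly" where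
  "specialize a b F = map_poly (eval2 a b) F"

text \<open>The subring \<open>\<int>[x - A, x - B]\<close> of \<open>\<rat>(A,B)[x]\<close>.\<close>

definition Z_x_minus_AB :: "rat poly poly fract poly set" where
  "Z_x_minus_AB = range (eval2 [:- ind_A, 1:] [:- ind_B, 1:])"

lemma eval2_ring_hom: "comm_ring_hom (eval2 a b)"
proof -
  interpret inner: comm_ring_hom "\<lambda>p :: int poly. poly (map_poly of_int p) a"
    by standard (simp_all only: of_int_poly_hom.hom_mult of_int_poly_hom.hom_add
      of_int_poly_hom.hom_one of_int_poly_hom.hom_zero poly_mult poly_add poly_1 poly_0)
  interpret outer: map_poly_comm_ring_hom "\<lambda>p :: int poly. poly (map_poly of_int p) a" ..
  show ?thesis
    by standard (simp_all only: eval2_def outer.hom_mult outer.hom_add outer.hom_one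
      outer.hom_zero poly_mult poly_add poly_1 poly_0)
qed

lemma eval2_generators:
  "eval2 a b [:[:0, 1:]:] = a" "eval2 a b [:0, 1:] = b"
  by (simp_all add: eval2_def Polynomial.map_poly_pCons)

lemma specialize_ring_hom: "comm_ring_hom (specialize a b)"
proof -
  interpret e: comm_ring_hom "eval2 a b" by (rule eval2_ring_hom)
  interpret m: map_poly_comm_ring_hom "eval2 a b" ..
  show ?thesis
    by standard (simp_all only: specialize_def m.hom_mult m.hom_add m.hom_one m.hom_zero)
qed

lemma eval2_ind:
  "eval2 ind_A ind_B h = to_fract (map_poly (map_poly of_int) h)"
proof -
  have inner: "poly (map_poly of_int p) ind_A = to_fract [:map_poly of_int p:]" for p :: "int poly"
  proof (induction p)
    case (pCons c p)
    have "(of_int c :: rat poly poly fract) = to_fract (of_int c)"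
      by (rule to_fract_hom.hom_of_int [symmetric])
    then have c: "(of_int c :: rat poly poly fract) = to_fract [:[:of_int c:]:]"
      by (simp only: of_int_poly)
    have "poly (map_poly of_int (pCons c p)) ind_A =
          to_fract ([:[:of_int c:]:] + [:[:0, 1:]:] * [:map_poly of_int p:])"
      by (simp only: Polynomial.map_poly_pCons [where f = of_int, OF of_int_0] poly_pCons pCons.IH [unfolded ind_A_def] c ind_A_def to_fract_mult to_fract_add)
    also have "[:[:of_int c:]:] + [:[:0, 1:]:] * [:map_poly of_int p:] =
          [:map_poly (of_int :: int \<Rightarrow> rat) (pCons c p):]"
      by (simp add: Polynomial.map_poly_pCons)
    finally show ?case .
  qed simp
  show ?thesis unfolding eval2_def inner
  proof (induction h)
    case (pCons c h)
    let ?i = "\<lambda>p :: int poly. to_fract [:map_poly (of_int :: int \<Rightarrow> rat) p:]"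
    have "?i 0 = 0"
      by simp
    then have "poly (map_poly ?i (pCons c h)) ind_B =
          to_fract ([:map_poly of_int c:] + [:0, 1:] * map_poly (map_poly of_int) h)"
      by (simp only: Polynomial.map_poly_pCons [where f = ?i] poly_pCons pCons.IH [unfolded ind_B_def] ind_B_def
            to_fract_mult to_fract_add)
    also have "[:map_poly of_int c:] + [:0, 1:] * map_poly (map_poly of_int) h =
          map_poly (map_poly (of_int :: int \<Rightarrow> rat)) (pCons c h)"
      by (simp add: Polynomial.map_poly_pCons)
    finally show ?case .
  qed simp
qed

lemma inj_specialize_ind: "inj (specialize ind_A ind_B)"
proof (rule injI)
  fix F G assume *: "specialize ind_A ind_B F = specialize ind_A ind_B G"
  have "inj (map_poly (map_poly (of_int :: int \<Rightarrow> rat)))"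
  proof (intro injI poly_eqI)
    fix p q :: "int poly poly" and i j
    assume "map_poly (map_poly (of_int :: int \<Rightarrow> rat)) p = map_poly (map_poly of_int) q"
    then have "coeff (coeff (map_poly (map_poly (of_int :: int \<Rightarrow> rat)) p) i) j =
               coeff (coeff (map_poly (map_poly of_int) q) i) j"
      by (rule arg_cong)
    then show "coeff (coeff p i) j = coeff (coeff q i) j"
      by (simp add: coeff_map_poly)
  qed
  then have "inj (eval2 ind_A ind_B)"
    by (auto simp: inj_def eval2_ind)
  moreover have "coeff (specialize ind_A ind_B H) i = eval2 ind_A ind_B (coeff H i)" for H i
    by (simp add: specialize_def coeff_map_poly eval2_def)
  ultimately show "F = G"
    by (metis * injD poly_eqI)
qed


definition s_coeff :: "nat \<Rightarrow> nat \<Rightarrow> nat \<Rightarrow> rat poly poly fract" where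
  "s_coeff d m n = (ind_A - ind_B) ^ ((m - d) * (n - d)) *
     const_frac (\<Prod>i=1..d. (fact (i - 1) * fact (m + n - d - i)) / (fact (m - i) * fact (n - i)))"

definition p_coeff :: "nat \<Rightarrow> nat \<Rightarrow> nat \<Rightarrow> rat poly poly fract" where
  "p_coeff d m n = 1 / (ind_A - ind_B) ^ d * of_nat ((m + n - d - 1) choose d)"

text \<open>\<open>P\<^sub>d\<^sup>(\<^sup>-\<^sup>n\<^sup>,\<^sup>-\<^sup>m\<^sup>)\<close> at \<open>((x - A) + (x - B)) / (B - A)\<close>, in \<open>\<rat>(A,B)[x]\<close>.\<close>

definition P_poly :: "nat \<Rightarrow> nat \<Rightarrow> nat \<Rightarrow> rat poly poly fract poly" where
  "P_poly d m n = pcompose (map_poly const_frac (jacobi_poly (- int n) (- int m) d))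
     (smult (1 / (ind_B - ind_A)) ([:- ind_A, 1:] + [:- ind_B, 1:]))"

definition Q_poly :: "nat \<Rightarrow> nat \<Rightarrow> nat \<Rightarrow> rat poly poly fract poly" where
  "Q_poly d m n = smult (s_coeff d m n / p_coeff d m n) (P_poly d m n)"

end

theory Submission
  imports Defs "HOL-Computational_Algebra.Formal_Power_Series"
begin

text \<open>
  Write \<open>u = x - \<alpha>\<close>, \<open>v = x - \<beta>\<close>, \<open>w = \<alpha> - \<beta> = v - u\<close>. The Pade approximant of type \<open>(d, m - d - 1)\<close> to
  \<open>(1 - X)\<^sup>n\<close>, at \<open>X = - u / w\<close> and \<open>1 - X = v / w\<close>, is a Bezout identity
  \<open>F u\<^sup>m + G v\<^sup>n = P\<close> with \<open>deg F < n - d\<close>, \<open>deg G < m - d\<close>, where \<open>P\<close> is the Jacobi polynomial of the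
  statement and the leading coefficient of \<open>G\<close> is explicit. By Cramer's rule the coefficient of \<open>G\<close> in degree
  \<open>m - d - 1\<close> times \<open>Sres\<^sub>d\<close> is a minor times \<open>P\<close>, and the minor is, up to sign, the principal coefficient
  of \<open>Sres\<^sub>d\<^sub>+\<^sub>1\<close>. Comparing coefficients of \<open>x\<^sup>d\<close> gives a recurrence for the principal coefficients,
  which is solved downwards from \<open>d = min m n\<close>. This settles every field of characteristic 0, in particular
  \<open>\<rat>(A,B)\<close>; the subresultant over \<open>\<int>[A,B]\<close> is an integral model of it and specializes to every field.
  For \<open>\<int>[x - A, x - B]\<close>, the formula depends on \<open>x - A\<close> and \<open>x - B\<close> only, so that it is obtained from its
  case \<open>(\<alpha>, \<beta>) = (0, B - A)\<close> by the substitution \<open>x \<mapsto> x - A\<close>, and \<open>B - A = (x - A) - (x - B)\<close>.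
\<close>

section \<open>Principal subresultant coefficients and Cramer's rule\<close>

text \<open>The columns come first from \<open>f\<close>, then from \<open>g\<close>; row \<open>i\<close> belongs to degree \<open>m + n - d - 1 - i\<close>.\<close>

definition psc_mat :: "nat \<Rightarrow> 'a::comm_ring_1 poly \<Rightarrow> 'a poly \<Rightarrow> 'a mat" where
  "psc_mat d f g = (let m = degree f; n = degree g; N = (m - d) + (n - d) in
     mat N N (\<lambda>(i, j).
       if j < n - d then coeff_int f (int m - int i + int j)
       else coeff_int g (int n - int i + int (j - (n - d)))))"

lemma psc_mat_carrier:
  "psc_mat d f g \<in> carrier_mat ((degree f - d) + (degree g - d)) ((degree f - d) + (degree g - d))"
  by (simp add: psc_mat_def Let_def)

lemma psc_mat_index:
  assumes "i < (degree f - d) + (degree g - d)" "j < (degree f - d) + (degree g - d)"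
  shows "psc_mat d f g $$ (i, j) =
    (if j < degree g - d then coeff_int f (int (degree f) - int i + int j)
     else coeff_int g (int (degree g) - int i + int (j - (degree g - d))))"
  using assms by (simp add: psc_mat_def Let_def)

text \<open>Taking the coefficient of x^d only changes the last row of the subresultant matrix. That
  row belongs to degree d in the row pattern of \<open>psc_mat\<close>, so one uniform formula
  covers all rows.\<close>

lemma coeff_subresultant_eq_det_psc_mat:
  assumes "d < min (degree f) (degree g)"
  shows "coeff (subresultant d f g) d = det (psc_mat d f g)"
proof -
  have "subresultant'_mat d d f g = psc_mat d f g"
  proof (rule eq_matI)
    fix i j
    assume "i < dim_row (psc_mat d f g)" "j < dim_col (psc_mat d f g)"
    then have ij: "i < (degree f - d) + (degree g - d)" "j < (degree f - d) + (degree g - d)"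
      using psc_mat_carrier[of d f g] by auto
    show "subresultant'_mat d d f g $$ (i, j) = psc_mat d f g $$ (i, j)"
      unfolding psc_mat_index[OF ij] subresultant'_mat_def Let_def index_mat(1)[OF ij] split
      using ij assms by (auto intro!: arg_cong[of _ _ "coeff_int _"])
  qed (auto simp: subresultant'_mat_def psc_mat_def Let_def)
  with coeff_subresultant[of d f g d] show ?thesis
    using assms by simp
qed

text \<open>The two matrices differ only in the last row, up to the embedding of constants. A
  cofactor along that row deletes it, so it is a constant polynomial.\<close>

lemma cofactor_subresultant_mat:
  fixes f g :: "'a::comm_ring_1 poly" and d :: nat
  defines "N \<equiv> (degree f - d) + (degree g - d)"
  assumes j: "j < N"
  shows "cofactor (subresultant_mat d f g) (N - 1) j = [:cofactor (psc_mat d f g) (N - 1) j:]"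
proof -
  have "mat_delete (subresultant_mat d f g) (N - 1) j =
        map_mat coeff_lift (mat_delete (psc_mat d f g) (N - 1) j)"
    (is "?L = ?R")
  proof (rule eq_matI)
    fix i k
    assume "i < dim_row ?R" "k < dim_col ?R"
    then have ik: "i < N - 1" "k < N - 1"
      using psc_mat_carrier[of d f g] by (auto simp: N_def)
    from j obtain N' where N': "N = Suc N'" by (cases N) auto
    have C: "subresultant_mat d f g \<in> carrier_mat (Suc N') (Suc N')"
            "psc_mat d f g \<in> carrier_mat (Suc N') (Suc N')"
      using psc_mat_carrier[of d f g] N' unfolding N_def by auto
    have ik': "insert_index N' i < N" "insert_index j k < N" "insert_index N' i < N - 1"
      using ik N' by (auto simp: insert_index_def)
    have "?L $$ (i, k) = subresultant_mat d f g $$ (insert_index N' i, insert_index j k)"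
      using mat_delete_index[OF C(1), of N' j i k] ik j N' by auto
    also have "\<dots> = [:psc_mat d f g $$ (insert_index N' i, insert_index j k):]"
      using ik'(3) unfolding subresultant_index_mat[OF ik'(1,2)[unfolded N_def]]
        psc_mat_index[OF ik'(1,2)[unfolded N_def]] N_def by auto
    also have "\<dots> = ?R $$ (i, k)"
      using mat_delete_index[OF C(2), of N' j i k] ik j N' C by auto
    finally show "?L $$ (i, k) = ?R $$ (i, k)" .
  qed (use psc_mat_carrier[of d f g] in auto)
  then show ?thesis
    unfolding cofactor_def by (simp add: minus_1_power_even del: one_pCons)
qed

text \<open>The top row belongs to degree m + n - d - 1, which only the highest shifts of f and of g
  reach. Column \<open>degree g - d\<close> is the highest shift of g; once it is deleted, the top
  row is (lead_coeff f, 0, ..., 0), and expansion along it leaves the matrix of order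
  \<open>Suc d\<close>.\<close>

lemma minor_psc_mat:
  fixes f g :: "'a::comm_ring_1 poly" and d :: nat
  assumes d: "d < min (degree f) (degree g)"
  defines "N \<equiv> (degree f - d) + (degree g - d)"
  shows "det (mat_delete (psc_mat d f g) (N - 1) (degree g - d)) =
         lead_coeff f * det (psc_mat (Suc d) f g)"
proof -
  let ?n = "degree g - d"
  define N' where "N' = N - 2"
  have N: "N = Suc (Suc N')" and N'': "(degree f - Suc d) + (degree g - Suc d) = N'"
    using d by (auto simp: N_def N'_def)
  define A where "A = mat_delete (psc_mat d f g) (N - 1) ?n"
  have C: "psc_mat d f g \<in> carrier_mat (Suc (Suc N')) (Suc (Suc N'))"
    using psc_mat_carrier[of d f g] N unfolding N_def by simp
  then have CA: "A \<in> carrier_mat (Suc N') (Suc N')"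
    unfolding A_def by (metis N diff_Suc_1 mat_delete_carrier)
  have A: "A $$ (i, k) = psc_mat d f g $$ (i, insert_index ?n k)" if "i < Suc N'" "k < Suc N'" for i k
  proof -
    have "?n < Suc (Suc N')" "N - 1 = Suc N'"
      using N d by (auto simp: N_def)
    with mat_delete_index[OF C, of "Suc N'" ?n i k] that show ?thesis
      unfolding A_def by (simp add: insert_index_def)
  qed
  \<comment> \<open>The columns to the right of the deleted one move left by one, hence
    \<open>Suc k\<close> in the second case.\<close>
  have A': "A $$ (i, k) = (if k < ?n then coeff_int f (int (degree f) - int i + int k)
       else coeff_int g (int (degree g) - int i + int (Suc k - ?n)))"
    if "i < Suc N'" "k < Suc N'" for i k
    using that N unfolding A[OF that] N_def
    by (subst psc_mat_index) (auto simp: insert_index_def)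
  have "det A = (\<Sum>k<Suc N'. A $$ (0, k) * cofactor A 0 k)"
    using laplace_expansion_row[OF CA, of 0] by simp
  also have "\<dots> = (\<Sum>k\<in>{0}. A $$ (0, k) * cofactor A 0 k)"
  proof (rule sum.mono_neutral_right)
    show "\<forall>k\<in>{..<Suc N'} - {0}. A $$ (0, k) * cofactor A 0 k = 0"
    proof
      fix k assume "k \<in> {..<Suc N'} - {0}"
      then have "A $$ (0, k) = 0"
        by (subst A') (auto simp: coeff_int_def intro!: coeff_eq_0)
      then show "A $$ (0, k) * cofactor A 0 k = 0" by simp
    qed
  qed auto
  also have "\<dots> = lead_coeff f * det (mat_delete A 0 0)"
    using d by (simp add: A' cofactor_def coeff_int_def)
  also have "mat_delete A 0 0 = psc_mat (Suc d) f g"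
  proof (rule eq_matI)
    fix i k
    assume "i < dim_row (psc_mat (Suc d) f g)" "k < dim_col (psc_mat (Suc d) f g)"
    then have ik: "i < N'" "k < N'"
      using psc_mat_carrier[of "Suc d" f g] N'' by auto
    then have "mat_delete A 0 0 $$ (i, k) = A $$ (Suc i, Suc k)"
      using mat_delete_index[OF CA, of 0 0 i k] by (simp add: insert_index_def)
    also have "\<dots> = psc_mat (Suc d) f g $$ (i, k)"
      using ik d N'' by (subst A', simp, simp, subst psc_mat_index, simp, simp)
        (auto intro!: arg_cong[of _ _ "coeff_int _"])
    finally show "mat_delete A 0 0 $$ (i, k) = psc_mat (Suc d) f g $$ (i, k)" .
  qed (use CA psc_mat_carrier[of "Suc d" f g] N'' in auto)
  finally show ?thesis unfolding A_def .
qed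

text \<open>Base case of the downward recurrence. All columns are shifts of the polynomial of
  smaller degree, so the matrix is lower triangular with unit diagonal; the transpose makes it upper
  triangular.\<close>

lemma det_psc_mat_min:
  assumes d: "d = min (degree f) (degree g)" and "lead_coeff f = 1" "lead_coeff g = 1"
  shows "det (psc_mat d f g) = 1"
proof (cases "degree g \<le> degree f")
  case True
  then have C: "psc_mat d f g \<in> carrier_mat (degree f - d) (degree f - d)"
    using psc_mat_carrier[of d f g] d by simp
  have P: "psc_mat d f g $$ (i, j) = coeff_int g (int (degree g) - int i + int j)"
    if "i < degree f - d" "j < degree f - d" for i j
    using that True d by (subst psc_mat_index) auto
  have "det (psc_mat d f g) = det (psc_mat d f g)\<^sup>T"
    using det_transpose[OF C] by simp
  also have "\<dots> = prod_list (diag_mat (psc_mat d f g)\<^sup>T)"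
    using C by (intro det_upper_triangular[of _ "degree f - d"] upper_triangularI)
      (auto simp: P coeff_int_def intro!: coeff_eq_0)
  also have "\<dots> = 1"
    using C assms(3) by (auto simp: diag_mat_def P coeff_int_def intro!: prod_list_neutral)
  finally show ?thesis .
next
  case False
  then have C: "psc_mat d f g \<in> carrier_mat (degree g - d) (degree g - d)"
    using psc_mat_carrier[of d f g] d by simp
  have P: "psc_mat d f g $$ (i, j) = coeff_int f (int (degree f) - int i + int j)"
    if "i < degree g - d" "j < degree g - d" for i j
    using that False d by (subst psc_mat_index) auto
  have "det (psc_mat d f g) = det (psc_mat d f g)\<^sup>T"
    using det_transpose[OF C] by simp
  also have "\<dots> = prod_list (diag_mat (psc_mat d f g)\<^sup>T)"
    using C by (intro det_upper_triangular[of _ "degree g - d"] upper_triangularI)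
      (auto simp: P coeff_int_def intro!: coeff_eq_0)
  also have "\<dots> = 1"
    using C assms(2) by (auto simp: diag_mat_def P coeff_int_def intro!: prod_list_neutral)
  finally show ?thesis .
qed


section \<open>Bezout identities as linear systems\<close>

lemma sum_lessThan_add:
  "sum f {..<a + b} = sum f {..<a} + (\<Sum>j<b. f (a + j) :: 'a::comm_monoid_add)" for a b :: nat
  by (induction b) (simp_all add: add_ac)

text \<open>The columns of the subresultant matrix list the shifts in descending order, hence the
  exponents \<open>k - 1 - j\<close>.\<close>

lemma mult_eq_sum_shifts:
  fixes F f :: "'a::comm_ring_1 poly"
  assumes "degree F < k"
  shows "F * f = (\<Sum>j<k. [:coeff F (k - 1 - j):] * (monom 1 (k - 1 - j) * f))"
proof -
  have "F = (\<Sum>i<k. monom (coeff F i) i)"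
    using poly_as_sum_of_monoms'[of F "k - 1"] assms
    by (cases k) (auto simp: lessThan_Suc_atMost)
  also have "\<dots> = (\<Sum>j<k. monom (coeff F (k - 1 - j)) (k - 1 - j))"
    using sum.nat_diff_reindex[of "\<lambda>i. monom (coeff F i) i" k] by simp
  finally have F: "F = (\<Sum>j<k. monom (coeff F (k - 1 - j)) (k - 1 - j))" .
  have "F * f = (\<Sum>j<k. monom (coeff F (k - 1 - j)) (k - 1 - j) * f)"
    by (subst F) (simp add: sum_distrib_right)
  also have "\<dots> = (\<Sum>j<k. [:coeff F (k - 1 - j):] * (monom 1 (k - 1 - j) * f))"
    by (intro sum.cong refl) (simp add: smult_monom flip: smult_monom_mult mult_smult_left)
  finally show ?thesis .
qed

lemma coeff_int_shift:
  "coeff (monom 1 e * f) p = coeff_int f (int p - int e)" for f :: "'a::comm_ring_1 poly"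
  by (auto simp: coeff_monom_mult coeff_int_def nat_diff_distrib' intro!: arg_cong[of _ _ "coeff f"])

text \<open>The coefficients of F and G form a vector \<open>c\<close> which the subresultant matrix
  sends to (0, ..., 0, h): the rows above the last read off coefficients of h in degrees above d.
  The adjugate then isolates one entry of \<open>c\<close>, without any division.\<close>

lemma subresultant_bezout:
  fixes f g F G h :: "'a::comm_ring_1 poly" and d :: nat
  assumes d: "d < min (degree f) (degree g)"
    and h: "F * f + G * g = h" "degree h \<le> d"
    and F: "degree F < degree g - d" and G: "degree G < degree f - d"
  shows "smult (coeff G (degree f - d - 1)) (subresultant d f g) =
         smult ((-1) ^ (degree f - d - 1) * (lead_coeff f * det (psc_mat (Suc d) f g))) h"
proof -
  let ?m = "degree f - d" and ?n = "degree g - d"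
  define N where "N = ?m + ?n"
  define M where "M = subresultant_mat d f g"
  define c where "c = vec N (\<lambda>j. if j < ?n then [:coeff F (?n - 1 - j):] else [:coeff G (?m - 1 - (j - ?n)):])"
  have M: "M \<in> carrier_mat N N" and c: "c \<in> carrier_vec N"
    by (auto simp: M_def N_def c_def)
  have pos: "0 < ?n" "0 < ?m" "0 < N"
    using d by (auto simp: N_def)
  have Mc: "(M *\<^sub>v c) $ i = (if i = N - 1 then h else 0)" if i: "i < N" for i
  proof -
    have "(M *\<^sub>v c) $ i = (\<Sum>j<N. M $$ (i, j) * c $ j)"
      using i M c by (auto simp: scalar_prod_def atLeast0LessThan)
    also have "\<dots> = (\<Sum>j<?n. M $$ (i, j) * c $ j) + (\<Sum>j<?m. M $$ (i, ?n + j) * c $ (?n + j))"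
      unfolding N_def by (subst add.commute) (rule sum_lessThan_add)
    also have "\<dots> = (if i = N - 1 then h else 0)"
    proof (cases "i = N - 1")
      case True
      have "(\<Sum>j<?n. M $$ (i, j) * c $ j) = F * f"
        unfolding mult_eq_sum_shifts[OF F, of f] M_def
        using i True d by (intro sum.cong refl) (subst subresultant_index_mat, auto simp: N_def c_def)
      moreover have "(\<Sum>j<?m. M $$ (i, ?n + j) * c $ (?n + j)) = G * g"
        unfolding mult_eq_sum_shifts[OF G, of g] M_def
        using i True d by (intro sum.cong refl) (subst subresultant_index_mat, auto simp: N_def c_def)
      ultimately show ?thesis
        using h True by simp
    next
      case False
      \<comment> \<open>The degree to which row \<open>i\<close> belongs; only the last row would
        give \<open>p = d\<close>.\<close>
      define p where "p = degree f + ?n - 1 - i"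
      have p: "d < p"
        using False i d by (auto simp: p_def N_def)
      have "(\<Sum>j<?n. M $$ (i, j) * c $ j) = [:coeff (F * f) p:]"
      proof -
        have "(\<Sum>j<?n. M $$ (i, j) * c $ j) = (\<Sum>j<?n. [:coeff ([:coeff F (?n - 1 - j):] * (monom 1 (?n - 1 - j) * f)) p:])"
          unfolding M_def
        proof (intro sum.cong refl)
          fix j assume j: "j \<in> {..<?n}"
          have "int p - int (?n - 1 - j) = int (degree f) - int i + int j"
            using j i False by (auto simp: p_def N_def)
          then have E: "coeff (monom 1 (?n - 1 - j) * f) p = coeff_int f (int (degree f) - int i + int j)"
            by (simp only: coeff_int_shift)
          show "subresultant_mat d f g $$ (i, j) * c $ j =
              [:coeff ([:coeff F (?n - 1 - j):] * (monom 1 (?n - 1 - j) * f)) p:]"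
            by (subst subresultant_index_mat) (use j i False E in \<open>auto simp: N_def c_def\<close>)
        qed
        then show ?thesis
          unfolding mult_eq_sum_shifts[OF F, of f] coeff_sum coeff_lift_hom.hom_sum .
      qed
      moreover have "(\<Sum>j<?m. M $$ (i, ?n + j) * c $ (?n + j)) = [:coeff (G * g) p:]"
      proof -
        have "(\<Sum>j<?m. M $$ (i, ?n + j) * c $ (?n + j)) = (\<Sum>j<?m. [:coeff ([:coeff G (?m - 1 - j):] * (monom 1 (?m - 1 - j) * g)) p:])"
          unfolding M_def
        proof (intro sum.cong refl)
          fix j assume j: "j \<in> {..<?m}"
          have "int p - int (?m - 1 - j) = int (degree g) - int i + int j"
            using j i False pos by (auto simp: p_def N_def)
          then have E: "coeff (monom 1 (?m - 1 - j) * g) p = coeff_int g (int (degree g) - int i + int j)"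
            by (simp only: coeff_int_shift)
          show "subresultant_mat d f g $$ (i, ?n + j) * c $ (?n + j) =
              [:coeff ([:coeff G (?m - 1 - j):] * (monom 1 (?m - 1 - j) * g)) p:]"
            by (subst subresultant_index_mat) (use j i False E in \<open>auto simp: N_def c_def\<close>)
        qed
        then show ?thesis
          unfolding mult_eq_sum_shifts[OF G, of g] coeff_sum coeff_lift_hom.hom_sum .
      qed
      ultimately have "(\<Sum>j<?n. M $$ (i, j) * c $ j) + (\<Sum>j<?m. M $$ (i, ?n + j) * c $ (?n + j)) =
          [:coeff (F * f + G * g) p:]"
        by simp
      also have "\<dots> = 0"
        using h p by (simp add: coeff_eq_0)
      finally show ?thesis using False by simp
    qed
    finally show ?thesis .
  qed
  \<comment> \<open>Entry \<open>?n\<close> is chosen because column \<open>?n\<close> is the first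
    one of g, where \<open>c\<close> holds the coefficient of G in degree \<open>?m - 1\<close>. It
    is computed in two ways.\<close>
  have "(adj_mat M *\<^sub>v (M *\<^sub>v c)) $ ?n = (\<Sum>k<N. cofactor M k ?n * (M *\<^sub>v c) $ k)"
    using M c pos by (auto simp: scalar_prod_def atLeast0LessThan adj_mat_def N_def)
  also have "\<dots> = (\<Sum>k<N. if k = N - 1 then cofactor M k ?n * h else 0)"
    by (intro sum.cong refl) (auto simp: Mc)
  also have "\<dots> = cofactor M (N - 1) ?n * h"
    using pos by simp
  also have "adj_mat M *\<^sub>v (M *\<^sub>v c) = (det M \<cdot>\<^sub>m 1\<^sub>m N) *\<^sub>v c"
    using adj_mat[OF M] M c assoc_mult_mat_vec[of "adj_mat M" N N M N c] by simp
  also have "\<dots> $ ?n = (\<Sum>k<N. (det M \<cdot>\<^sub>m 1\<^sub>m N) $$ (?n, k) * c $ k)"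
    using c pos by (auto simp: scalar_prod_def atLeast0LessThan N_def intro!: sum.cong)
  also have "\<dots> = (\<Sum>k<N. if k = ?n then det M * c $ k else 0)"
    using pos by (intro sum.cong refl) (auto simp: N_def)
  also have "\<dots> = det M * c $ ?n"
    using pos by (simp add: N_def)
  finally have "det M * [:coeff G (?m - 1):] = cofactor M (N - 1) ?n * h"
    using pos by (simp add: c_def N_def)
  moreover have "cofactor M (N - 1) ?n = [:(-1) ^ (N - 1 + ?n) * (lead_coeff f * det (psc_mat (Suc d) f g)):]"
    using cofactor_subresultant_mat[of ?n f d g] pos minor_psc_mat[OF d]
    unfolding M_def N_def by (simp add: cofactor_def)
  \<comment> \<open>\<open>N - 1 + ?n\<close> equals \<open>?m - 1\<close> plus twice
    \<open>?n\<close>.\<close>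
  moreover have "(-1 :: 'a) ^ (N - 1 + ?n) = (-1) ^ (?m - 1)"
    using pos by (intro minus_1_even_eqI) (auto simp: N_def)
  ultimately show ?thesis
    unfolding M_def subresultant_def by (simp add: mult.commute)
qed

section \<open>Pade approximants of a binomial power\<close>

text \<open>Upper negation frees the upper argument of the second binomial from \<open>t\<close>,
  Vandermonde sums, and a second negation returns to natural arguments.\<close>

lemma binomial_diff_expand:
  assumes "i \<le> M" "d \<le> M"
  shows "(\<Sum>t\<le>d. (-1) ^ t * of_nat (i choose t) * of_nat ((M - t) choose (d - t)) :: 'a::field_char_0) =
           of_nat ((M - i) choose d)"
proof -
  have neg: "of_nat ((M - t) choose (d - t)) =
      (-1) ^ (d - t) * ((of_nat d - of_nat M - 1 :: 'a) gchoose (d - t))" if "t \<le> d" for t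
    using gbinomial_negated_upper[of "of_nat (M - t) :: 'a" "d - t"] that assms
    by (simp add: binomial_gbinomial of_nat_diff)
  have "(\<Sum>t\<le>d. (-1) ^ t * of_nat (i choose t) * of_nat ((M - t) choose (d - t)) :: 'a) =
        (\<Sum>t\<le>d. (-1) ^ d * ((of_nat i gchoose t) * ((of_nat d - of_nat M - 1) gchoose (d - t))))"
    by (intro sum.cong refl) (simp add: neg binomial_gbinomial[of i] power_add[symmetric] mult_ac)
  also have "\<dots> = (-1) ^ d * ((of_nat i + (of_nat d - of_nat M - 1)) gchoose d)"
    by (simp add: sum_distrib_left[symmetric] gbinomial_Vandermonde atMost_atLeast0)
  also have "\<dots> = of_nat ((M - i) choose d)"
    using gbinomial_negated_upper[of "of_nat (M - i) :: 'a" d] assms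
    by (simp add: binomial_gbinomial of_nat_diff algebra_simps)
  finally show ?thesis .
qed

text \<open>Up to sign the factors are the binomials of -a and -b, so this is Vandermonde, or (1 -
  X)^(-a) times (1 - X)^(-b).\<close>

lemma sum_binomial_rising:
  fixes a b d :: nat
  assumes "a > 0" "b > 0"
  shows "(\<Sum>t\<le>d. ((a + t - 1) choose t) * ((b + (d - t) - 1) choose (d - t))) = (a + b + d - 1) choose d"
proof -
  have neg: "of_nat ((c + t - 1) choose t) = (-1) ^ t * ((- of_nat c :: rat) gchoose t)"
    if "c > 0" for c t
    using that by (simp add: gbinomial_minus binomial_gbinomial of_nat_diff)
  have "(of_nat (\<Sum>t\<le>d. ((a + t - 1) choose t) * ((b + (d - t) - 1) choose (d - t))) :: rat) =
        (\<Sum>t\<le>d. (-1) ^ d * ((- of_nat a gchoose t) * (- of_nat b gchoose (d - t))))"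
    unfolding of_nat_sum of_nat_mult neg[OF assms(1)] neg[OF assms(2)]
    by (intro sum.cong refl) (simp add: power_add[symmetric] mult_ac)
  also have "\<dots> = (-1) ^ d * ((- of_nat (a + b)) gchoose d)"
    by (simp add: sum_distrib_left[symmetric] gbinomial_Vandermonde atMost_atLeast0)
  also have "\<dots> = of_nat ((a + b + d - 1) choose d)"
    using assms by (simp only: neg)
  finally show ?thesis
    by (simp only: of_nat_eq_iff)
qed

text \<open>Coordinates of the numerator in the basis (-X)^t (1 - X)^(d - t), in which it becomes
  the Jacobi polynomial after substitution.\<close>

definition pade_num_coeff :: "nat \<Rightarrow> nat \<Rightarrow> nat \<Rightarrow> nat \<Rightarrow> nat" where
  "pade_num_coeff d m n t = ((n - d + t - 1) choose t) * ((m - t - 1) choose (d - t))"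

text \<open>Coefficients of X^i in the multiplier of (1 - X)^n.\<close>

definition pade_den_coeff :: "nat \<Rightarrow> nat \<Rightarrow> nat \<Rightarrow> nat \<Rightarrow> nat" where
  "pade_den_coeff d m n i = ((n - d + i - 1) choose i) * ((m - i - 1) choose d)"

lemma coeff_one_minus_X_power:
  "coeff ([:1, - 1:] ^ n :: 'a::comm_ring_1 poly) k = (-1) ^ k * of_nat (n choose k)"
proof (cases "k \<le> n")
  case True
  then show ?thesis
    using coeff_linear_poly_power[of k n "1::'a" "-1"] by simp
next
  case False
  then show ?thesis
    using le_less_trans[OF degree_power_le[of "[:1, - 1 :: 'a:]" n], of k]
    by (simp add: coeff_eq_0 binomial_eq_0 split: if_splits)
qed

text \<open>Both sides are coefficients of X^k, of the multiplier times (1 - X)^n and of the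
  numerator. Expanding (m - i - 1 choose d) over \<open>t\<close> by
  \<open>binomial_diff_expand\<close>, which needs i < m, reduces this to one identity for each
  \<open>t\<close>.\<close>

lemma pade_den_coeff_convolution:
  assumes d: "d < min m n" and k: "k < m"
  shows "(\<Sum>i\<le>k. of_nat (pade_den_coeff d m n i) * ((-1) ^ (k - i) * of_nat (n choose (k - i)))) =
         (\<Sum>t\<le>min d k. (-1) ^ k * of_nat (pade_num_coeff d m n t) * of_nat ((d - t) choose (k - t)) :: 'a::field_char_0)"
    (is "?L = ?R")
proof -
  define e where "e i = (of_nat ((n - d + i - 1) choose i) :: 'a)" for i
  define c where "c t = (of_nat ((m - 1 - t) choose (d - t)) :: 'a)" for t
  \<comment> \<open>Generating function: the sum of \<open>e i * (i choose t)\<close> X^i is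
    \<open>e t\<close> X^t (1 - X)^(-(n - d + t)); multiplication by (1 - X)^n leaves
    \<open>e t\<close> X^t (1 - X)^(d - t).\<close>
  have inner: "(\<Sum>i\<le>k. e i * ((-1) ^ (k - i) * of_nat (n choose (k - i))) * of_nat (i choose t)) =
      (if t \<le> k then e t * ((-1) ^ (k - t) * of_nat ((d - t) choose (k - t))) else 0)"
    (is "?S = _") if t: "t \<le> d" for t
  proof (cases "t \<le> k")
    case True
    have "?S = (\<Sum>i=t..k. e i * ((-1) ^ (k - i) * of_nat (n choose (k - i))) * of_nat (i choose t))"
      by (rule sum.mono_neutral_right) auto
    also have "\<dots> = (\<Sum>s=0..k - t. e (s + t) * ((-1) ^ (k - t - s) * of_nat (n choose (k - t - s))) *
        of_nat ((s + t) choose t))"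
      using sum.shift_bounds_cl_nat_ivl[of _ 0 t "k - t"] True by (simp add: add.commute)
    also have "\<dots> = (\<Sum>s=0..k - t. e t * (-1) ^ (k - t) *
        (((of_nat d - of_nat n - of_nat t) gchoose s) * (of_nat n gchoose (k - t - s))))"
    proof (intro sum.cong refl)
      fix s assume s: "s \<in> {0..k - t}"
      have "((n - d + (s + t) - 1) choose (s + t)) * ((s + t) choose t) =
            ((n - d + t - 1) choose t) * ((n - d + (s + t) - 1) choose s)"
      proof -
        have "((n - d + (s + t) - 1) choose (s + t)) * ((s + t) choose s) =
              ((n - d + (s + t) - 1) choose s) * ((n - d + (s + t) - 1 - s) choose (s + t - s))"
          using d by (intro choose_mult) auto
        moreover have "(s + t) choose s = (s + t) choose t"
          using binomial_symmetric[of s "s + t"] by simp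
        moreover have "n - d + (s + t) - 1 - s = n - d + t - 1"
          using d by auto
        ultimately show ?thesis by (simp add: mult_ac)
      qed
      then have E: "e (s + t) * of_nat ((s + t) choose t) =
          e t * of_nat ((n - d + (s + t) - 1) choose s)"
        unfolding e_def by (simp only: of_nat_mult[symmetric])
      \<comment> \<open>Upper negation, so that the upper argument no longer contains
        \<open>s\<close> and Vandermonde applies.\<close>
      have G: "of_nat ((n - d + (s + t) - 1) choose s) =
          (-1) ^ s * ((of_nat d - of_nat n - of_nat t) gchoose s :: 'a)"
        using d gbinomial_negated_upper[of "of_nat (n - d + (s + t) - 1) :: 'a" s]
        by (simp add: binomial_gbinomial of_nat_diff algebra_simps)
      have "(-1 :: 'a) ^ (k - t) = (-1) ^ s * (-1) ^ (k - t - s)"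
        using s by (metis atLeastAtMost_iff le_add_diff_inverse power_add)
      then show "e (s + t) * ((-1) ^ (k - t - s) * of_nat (n choose (k - t - s))) * of_nat ((s + t) choose t) =
        e t * (-1) ^ (k - t) *
        (((of_nat d - of_nat n - of_nat t) gchoose s) * (of_nat n gchoose (k - t - s)))"
        using E unfolding G binomial_gbinomial[of n, symmetric] by (simp add: mult_ac)
    qed
    also have "\<dots> = e t * (-1) ^ (k - t) * ((of_nat (d - t)) gchoose (k - t))"
      using t gbinomial_Vandermonde[of "of_nat d - of_nat n - of_nat t :: 'a" "of_nat n" "k - t"]
      by (simp add: sum_distrib_left[symmetric] of_nat_diff)
    finally show ?thesis
      using True by (simp add: binomial_gbinomial mult_ac)
  qed (auto intro!: sum.neutral)
  have "?L = (\<Sum>i\<le>k. \<Sum>t\<le>d. (-1) ^ t * c t *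
      (e i * ((-1) ^ (k - i) * of_nat (n choose (k - i))) * of_nat (i choose t)))"
  proof (intro sum.cong refl)
    fix i assume "i \<in> {..k}"
    then have "i \<le> m - 1" "d \<le> m - 1"
      using d k by auto
    from binomial_diff_expand[OF this, where ?'a = 'a]
    have "of_nat ((m - i - 1) choose d) = (\<Sum>t\<le>d. (-1) ^ t * of_nat (i choose t) * c t)"
      by (simp add: c_def)
    then show "of_nat (pade_den_coeff d m n i) * ((-1) ^ (k - i) * of_nat (n choose (k - i))) =
       (\<Sum>t\<le>d. (-1) ^ t * c t * (e i * ((-1) ^ (k - i) * of_nat (n choose (k - i))) * of_nat (i choose t)))"
      unfolding pade_den_coeff_def of_nat_mult e_def[symmetric]
      by (simp add: sum_distrib_left sum_distrib_right mult_ac)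
  qed
  also have "\<dots> = (\<Sum>t\<le>d. (-1) ^ t * c t * (\<Sum>i\<le>k. e i * ((-1) ^ (k - i) * of_nat (n choose (k - i))) * of_nat (i choose t)))"
    by (subst sum.swap) (simp add: sum_distrib_left)
  also have "\<dots> = (\<Sum>t\<le>d. if t \<le> k then (-1) ^ t * c t * (e t * ((-1) ^ (k - t) * of_nat ((d - t) choose (k - t)))) else 0)"
    by (intro sum.cong refl) (simp add: inner)
  also have "\<dots> = (\<Sum>t\<le>min d k. (-1) ^ t * c t * (e t * ((-1) ^ (k - t) * of_nat ((d - t) choose (k - t)))))"
    by (rule sum.mono_neutral_cong_right) auto
  also have "\<dots> = ?R"
  proof (intro sum.cong refl)
    fix t assume "t \<in> {..min d k}"
    then have "(-1 :: 'a) ^ k = (-1) ^ t * (-1) ^ (k - t)"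
      by (simp add: power_add[symmetric])
    then show "(-1) ^ t * c t * (e t * ((-1) ^ (k - t) * of_nat ((d - t) choose (k - t)))) =
        (-1) ^ k * of_nat (pade_num_coeff d m n t) * of_nat ((d - t) choose (k - t))"
      by (simp add: pade_num_coeff_def c_def e_def diff_commute mult_ac)
  qed
  finally show ?thesis .
qed

text \<open>By the convolution identity the product on the left agrees with the numerator below
  degree m, so X^m divides the difference; its degree bounds that of F.\<close>

lemma pade_power:
  assumes d: "d < min m n"
  obtains F G :: "'a::field_char_0 poly" where
    "G * [:1, - 1:] ^ n =
      (\<Sum>t\<le>d. smult (of_nat (pade_num_coeff d m n t)) ([:0, - 1:] ^ t * [:1, - 1:] ^ (d - t))) + monom 1 m * F"
    "degree F < n - d" "degree G = m - d - 1"
    "lead_coeff G = of_nat ((m + n - 2 * d - 2) choose (m - d - 1))"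
proof -
  define G :: "'a poly" where "G = (\<Sum>i<m - d. monom (of_nat (pade_den_coeff d m n i)) i)"
  define H :: "'a poly" where
    "H = (\<Sum>t\<le>d. smult (of_nat (pade_num_coeff d m n t)) ([:0, - 1:] ^ t * [:1, - 1:] ^ (d - t)))"
  \<comment> \<open>For m - d \<le> i < m the factor (m - i - 1 choose d) vanishes. For i \<ge> m
    truncated subtraction would give (0 choose d), which is 1 if d = 0, hence the case
    distinction.\<close>
  have G: "coeff G i = (if i < m then of_nat (pade_den_coeff d m n i) else 0)" for i
    using d by (auto simp: G_def coeff_sum pade_den_coeff_def)
  have X: "[:0, - 1 :: 'a:] = monom (- 1) 1"
    by (simp add: monom_altdef)
  have H: "coeff H k = (\<Sum>t\<le>min d k. (-1) ^ k * of_nat (pade_num_coeff d m n t) * of_nat ((d - t) choose (k - t)))" for k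
  proof -
    have "coeff H k = (\<Sum>t\<le>d. if t \<le> k then (-1) ^ k * of_nat (pade_num_coeff d m n t) * of_nat ((d - t) choose (k - t)) else 0)"
      unfolding H_def coeff_sum
    proof (intro sum.cong refl)
      fix t
      have "(-1 :: 'a) ^ k = (-1) ^ t * (-1) ^ (k - t)" if "t \<le> k"
        using that by (simp add: power_add[symmetric])
      then show "coeff (smult (of_nat (pade_num_coeff d m n t)) ([:0, - 1:] ^ t * [:1, - 1:] ^ (d - t))) k =
        (if t \<le> k then (-1) ^ k * of_nat (pade_num_coeff d m n t) * of_nat ((d - t) choose (k - t)) else (0 :: 'a))"
        by (simp add: X monom_power coeff_monom_mult coeff_one_minus_X_power mult_ac)
    qed
    also have "\<dots> = (\<Sum>t\<le>min d k. (-1) ^ k * of_nat (pade_num_coeff d m n t) * of_nat ((d - t) choose (k - t)))"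
      by (rule sum.mono_neutral_cong_right) auto
    finally show ?thesis .
  qed
  have degG: "degree G \<le> m - d - 1"
    unfolding G_def by (rule degree_sum_le) (auto intro: order.trans[OF degree_monom_le])
  have degP: "degree ([:1, - 1 :: 'a:] ^ k) \<le> k" for k
    using degree_power_le[of "[:1, - 1 :: 'a:]" k] by simp
  have degP0: "degree ([:0, - 1 :: 'a:] ^ k) \<le> k" for k
    using degree_power_le[of "[:0, - 1 :: 'a:]" k] by simp
  have degH: "degree H \<le> d"
    unfolding H_def
  proof (rule degree_sum_le)
    fix t assume t: "t \<in> {..d}"
    have "degree ([:0, - 1 :: 'a:] ^ t * [:1, - 1:] ^ (d - t)) \<le> t + (d - t)"
      using degree_mult_le degP degP0 by (meson add_mono order_trans)
    then show "degree (smult (of_nat (pade_num_coeff d m n t)) ([:0, - 1 :: 'a:] ^ t * [:1, - 1:] ^ (d - t))) \<le> d"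
      using t degree_smult_le le_trans by fastforce
  qed simp
  define R where "R = G * [:1, - 1:] ^ n - H"
  have "coeff R k = 0" if "k < m" for k
    using pade_den_coeff_convolution[OF d that, where ?'a = 'a] that
    by (simp add: R_def H coeff_mult G coeff_one_minus_X_power)
  then have "monom 1 m dvd R"
    by (simp add: monom_1_dvd_iff')
  then obtain F where F: "R = monom 1 m * F" by auto
  then have cF: "coeff F k = coeff R (m + k)" for k
    by (simp add: coeff_monom_mult)
  have degR: "degree R \<le> m - d - 1 + n"
    unfolding R_def using degH d degG degP[of n]
    by (intro degree_diff_le order.trans[OF degree_mult_le]) auto
  have "degree F \<le> n - d - 1"
    using degR d by (intro degree_le) (auto simp: cF intro!: coeff_eq_0)
  moreover have "G * [:1, - 1:] ^ n = H + monom 1 m * F"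
    using F by (simp add: R_def algebra_simps)
  \<comment> \<open>At the top index the second factor of \<open>pade_den_coeff\<close> is (d choose
    d).\<close>
  moreover have lc: "coeff G (m - d - 1) = of_nat ((m + n - 2 * d - 2) choose (m - d - 1))"
  proof -
    have "n - d + (m - d - 1) - 1 = m + n - 2 * d - 2" "m - (m - d - 1) - 1 = d"
      using d by auto
    then show ?thesis
      using d by (simp add: G pade_den_coeff_def)
  qed
  moreover have "degree G = m - d - 1"
    using degG le_degree[of G "m - d - 1"] lc d by (intro antisym) auto
  ultimately show ?thesis
    using d that[of G F] unfolding H_def by auto
qed

section \<open>Subresultants of linear powers in characteristic 0\<close>

text \<open>The explicit Jacobi expansion over any field, so that it can be used both at
  \<open>ind_A\<close>, \<open>ind_B\<close> and at the translated pair \<open>0\<close>,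
  \<open>ind_B - ind_A\<close>.\<close>

definition jacobi_form :: "nat \<Rightarrow> nat \<Rightarrow> nat \<Rightarrow> 'a::field \<Rightarrow> 'a \<Rightarrow> 'a poly" where
  "jacobi_form d m n \<alpha> \<beta> = (\<Sum>j\<le>d. smult (of_nat (((n - d + j - 1) choose j) * ((m - j - 1) choose (d - j))) / (\<alpha> - \<beta>) ^ d)
     ([:- \<alpha>, 1:] ^ j * [:- \<beta>, 1:] ^ (d - j)))"

lemma degree_pCons_one_power: "degree (pCons a 1 ^ n :: 'a::field poly) = n"
  using degree_linear_power[of a n] by simp

lemma coeff_pCons_one_power: "coeff (pCons a 1 ^ n :: 'a::field poly) n = 1"
  using lead_coeff_power[of "pCons a 1" n] by (simp add: degree_pCons_one_power)

lemma degree_jacobi_form: "degree (jacobi_form d m n \<alpha> \<beta>) \<le> d"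
  unfolding jacobi_form_def
  by (intro degree_sum_le) (auto intro!: order.trans[OF degree_smult_le] order.trans[OF degree_mult_le]
    simp: degree_pCons_one_power)

text \<open>Each product of linear powers is monic of degree d, so the binomial factors are simply
  summed; m - j - 1 = (m - d) + (d - j) - 1 brings the sum into the form of
  \<open>sum_binomial_rising\<close>.\<close>

lemma coeff_jacobi_form:
  assumes "d < min m n"
  shows "coeff (jacobi_form d m n \<alpha> \<beta>) d = of_nat ((m + n - d - 1) choose d) / (\<alpha> - \<beta>) ^ d"
proof -
  have "coeff ([:- \<alpha>, 1:] ^ j * [:- \<beta>, 1:] ^ (d - j)) d = 1" if "j \<le> d" for j
  proof -
    have "lead_coeff ([:- \<alpha>, 1:] ^ j * [:- \<beta>, 1:] ^ (d - j)) = 1"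
      by (simp add: lead_coeff_mult lead_coeff_power del: coeff_mult)
    moreover have "degree ([:- \<alpha>, 1:] ^ j * [:- \<beta>, 1:] ^ (d - j)) = d"
      using that by (subst degree_mult_eq) (auto simp: degree_pCons_one_power)
    ultimately show ?thesis by metis
  qed
  then have "coeff (jacobi_form d m n \<alpha> \<beta>) d =
    of_nat (\<Sum>j\<le>d. ((n - d + j - 1) choose j) * ((m - j - 1) choose (d - j))) / (\<alpha> - \<beta>) ^ d"
    unfolding jacobi_form_def coeff_sum of_nat_sum sum_divide_distrib
    by (intro sum.cong refl) simp
  also have "(\<Sum>j\<le>d. ((n - d + j - 1) choose j) * ((m - j - 1) choose (d - j))) =
      (\<Sum>j\<le>d. ((n - d + j - 1) choose j) * ((m - d + (d - j) - 1) choose (d - j)))"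
    using assms by (intro sum.cong refl) simp
  also have "\<dots> = ((n - d) + (m - d) + d - 1) choose d"
    using assms by (intro sum_binomial_rising) auto
  also have "(n - d) + (m - d) + d - 1 = m + n - d - 1"
    using assms by auto
  finally show ?thesis .
qed

lemma jacobi_form_bezout:
  fixes \<alpha> \<beta> :: "'a::field_char_0"
  assumes d: "d < min m n" and ne: "\<alpha> \<noteq> \<beta>"
  obtains F G where
    "F * [:- \<alpha>, 1:] ^ m + G * [:- \<beta>, 1:] ^ n = jacobi_form d m n \<alpha> \<beta>"
    "degree F < n - d" "degree G < m - d"
    "coeff G (m - d - 1) = (- 1) ^ (m - d - 1) * of_nat ((m + n - 2 * d - 2) choose (m - d - 1)) / (\<alpha> - \<beta>) ^ (m + n - d - 1)"
proof -
  obtain F\<^sub>0 G\<^sub>0 :: "'a poly" where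
    eq: "G\<^sub>0 * [:1, - 1:] ^ n =
      (\<Sum>t\<le>d. smult (of_nat (pade_num_coeff d m n t)) ([:0, - 1:] ^ t * [:1, - 1:] ^ (d - t))) + monom 1 m * F\<^sub>0"
    and F\<^sub>0: "degree F\<^sub>0 < n - d" and G\<^sub>0: "degree G\<^sub>0 = m - d - 1"
    "lead_coeff G\<^sub>0 = of_nat ((m + n - 2 * d - 2) choose (m - d - 1))"
    by (rule pade_power[OF d])
  define w where "w = \<alpha> - \<beta>"
  have w: "w \<noteq> 0" using ne by (simp add: w_def)
  \<comment> \<open>The value -u/w for X, so that -X becomes u/w and 1 - X becomes v/w. Its leading
    coefficient -1/w accounts for the sign and for m - d - 1 of the powers of w in the last
    claim.\<close>
  define \<sigma> where "\<sigma> = smult (- 1 / w) [:- \<alpha>, 1:]"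
  have deg\<sigma>: "degree \<sigma> = 1" "lead_coeff \<sigma> = - 1 / w"
    using w by (auto simp: \<sigma>_def)
  have s1: "pcompose [:1, - 1:] \<sigma> = smult (1 / w) [:- \<beta>, 1:]"
    using w by (simp add: poly_eq_poly_eq_iff[symmetric] fun_eq_iff poly_pcompose \<sigma>_def field_simps)
      (simp add: w_def algebra_simps)
  have s0: "pcompose [:0, - 1:] \<sigma> = smult (1 / w) [:- \<alpha>, 1:]"
    by (simp add: pcompose_pCons \<sigma>_def)
  have sX: "pcompose (monom 1 m) \<sigma> = smult ((- 1 / w) ^ m) ([:- \<alpha>, 1:] ^ m)"
  proof -
    have "pcompose (monom 1 m) \<sigma> = \<sigma> ^ m"
      by (simp add: monom_altdef pcompose_hom.hom_power pcompose_pCons)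
    then show ?thesis
      by (simp only: \<sigma>_def smult_power)
  qed
  have "pcompose (G\<^sub>0 * [:1, - 1:] ^ n) \<sigma> = smult (1 / w ^ n) (pcompose G\<^sub>0 \<sigma>) * [:- \<beta>, 1:] ^ n"
    by (simp only: pcompose_mult pcompose_hom.hom_power s1 smult_power power_one_over
      mult_smult_left mult_smult_right)
  moreover have "pcompose (G\<^sub>0 * [:1, - 1:] ^ n) \<sigma> =
      jacobi_form d m n \<alpha> \<beta> + smult ((- 1 / w) ^ m) (pcompose F\<^sub>0 \<sigma>) * [:- \<alpha>, 1:] ^ m"
  proof -
    have "pcompose (\<Sum>t\<le>d. smult (of_nat (pade_num_coeff d m n t)) ([:0, - 1:] ^ t * [:1, - 1:] ^ (d - t))) \<sigma> =
        jacobi_form d m n \<alpha> \<beta>"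
      unfolding pcompose_sum jacobi_form_def
    proof (intro sum.cong refl)
      fix t assume "t \<in> {..d}"
      then have "(1 / w) ^ t * (1 / w) ^ (d - t) = 1 / w ^ d"
        by (simp add: power_one_over power_add[symmetric])
      then have "smult (1 / w) [:- \<alpha>, 1:] ^ t * smult (1 / w) [:- \<beta>, 1:] ^ (d - t) =
          smult (1 / w ^ d) ([:- \<alpha>, 1:] ^ t * [:- \<beta>, 1:] ^ (d - t))"
        by (simp only: smult_power mult_smult_left mult_smult_right smult_smult mult.commute)
      then show "pcompose (smult (of_nat (pade_num_coeff d m n t)) ([:0, - 1:] ^ t * [:1, - 1:] ^ (d - t))) \<sigma> =
        smult (of_nat (((n - d + t - 1) choose t) * ((m - t - 1) choose (d - t))) / (\<alpha> - \<beta>) ^ d)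
          ([:- \<alpha>, 1:] ^ t * [:- \<beta>, 1:] ^ (d - t))"
        by (simp only: pcompose_smult pcompose_mult pcompose_hom.hom_power s0 s1)
          (simp add: pade_num_coeff_def w_def)
    qed
    then show ?thesis
      unfolding eq by (simp add: pcompose_add pcompose_mult sX mult.commute)
  qed
  ultimately have "smult (- ((- 1 / w) ^ m)) (pcompose F\<^sub>0 \<sigma>) * [:- \<alpha>, 1:] ^ m +
      smult (1 / w ^ n) (pcompose G\<^sub>0 \<sigma>) * [:- \<beta>, 1:] ^ n = jacobi_form d m n \<alpha> \<beta>"
    by (simp add: algebra_simps)
  moreover have "degree (smult (- ((- 1 / w) ^ m)) (pcompose F\<^sub>0 \<sigma>)) < n - d"
    using F\<^sub>0 deg\<sigma> w by (simp add: degree_pcompose)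
  moreover have "degree (smult (1 / w ^ n) (pcompose G\<^sub>0 \<sigma>)) < m - d"
    using G\<^sub>0 deg\<sigma> d by (auto simp: degree_pcompose)
  moreover have "coeff (smult (1 / w ^ n) (pcompose G\<^sub>0 \<sigma>)) (m - d - 1) =
      (- 1) ^ (m - d - 1) * of_nat ((m + n - 2 * d - 2) choose (m - d - 1)) / (\<alpha> - \<beta>) ^ (m + n - d - 1)"
  proof -
    have "coeff (pcompose G\<^sub>0 \<sigma>) (m - d - 1) = lead_coeff (pcompose G\<^sub>0 \<sigma>)"
      using G\<^sub>0 deg\<sigma> by (simp add: degree_pcompose)
    also have "\<dots> = lead_coeff G\<^sub>0 * (- 1 / w) ^ (m - d - 1)"
      using G\<^sub>0 deg\<sigma> by (subst lead_coeff_comp) auto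
    finally have "coeff (smult (1 / w ^ n) (pcompose G\<^sub>0 \<sigma>)) (m - d - 1) =
        (- 1) ^ (m - d - 1) * of_nat ((m + n - 2 * d - 2) choose (m - d - 1)) / (w ^ (m - d - 1) * w ^ n)"
      using G\<^sub>0 unfolding power_divide by (simp add: mult.commute)
    also have "w ^ (m - d - 1) * w ^ n = (\<alpha> - \<beta>) ^ (m + n - d - 1)"
    proof -
      have "m - d - 1 + n = m + n - d - 1" using d by auto
      then show ?thesis by (metis power_add w_def)
    qed
    finally show ?thesis .
  qed
  ultimately show ?thesis by (rule that)
qed

section \<open>The numerical factor of s_d and the recurrence of the principal coefficients\<close>

definition psc_const :: "nat \<Rightarrow> nat \<Rightarrow> nat \<Rightarrow> 'a::field_char_0" where
  "psc_const d m n = (\<Prod>i=1..d. (fact (i - 1) * fact (m + n - d - i)) / (fact (m - i) * fact (n - i)))"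

lemma psc_const_commute: "psc_const d m n = psc_const d n m"
  by (simp add: psc_const_def add.commute mult.commute)

text \<open>At d = n the factors (m - i)! cancel, and the reversal of i matches the remaining
  factorials.\<close>

lemma psc_const_right: "n \<le> m \<Longrightarrow> psc_const n m n = 1"
proof -
  assume "n \<le> m"
  have "psc_const n m n = (\<Prod>i=1..n. fact (i - 1) / fact (n - i) :: 'a)"
    unfolding psc_const_def by (intro prod.cong refl) (simp add: fact_nonzero)
  also have "\<dots> = (\<Prod>i=1..n. fact (i - 1)) / (\<Prod>i=1..n. fact (n - i))"
    by (simp add: prod_dividef)
  also have "(\<Prod>i=1..n. fact (n - i)) = (\<Prod>i=1..n. fact (i - 1) :: 'a)"
    by (rule prod.reindex_bij_witness[of _ "\<lambda>i. n + 1 - i" "\<lambda>i. n + 1 - i"]) auto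
  finally show ?thesis by simp
qed

lemma psc_const_min: "psc_const (min m n) m n = 1"
proof (cases "n \<le> m")
  case False
  then show ?thesis
    by (subst psc_const_commute) (simp add: psc_const_right min_absorb1)
qed (simp add: psc_const_right min_absorb2)

text \<open>Passing to \<open>Suc d\<close> shifts the index of the factors \<open>g\<close>, so
  that \<open>g 1\<close> drops out while \<open>g (Suc d)\<close> and
  \<open>g (Suc (Suc d))\<close> enter, together with the new factor \<open>h (Suc d)\<close>. The
  quotient of the two binomials is exactly this change.\<close>

lemma psc_const_Suc:
  assumes d: "d < min m n"
  shows "psc_const d m n * of_nat ((m + n - 2 * d - 2) choose (m - d - 1)) =
         psc_const (Suc d) m n * of_nat ((m + n - d - 1) choose d)"
proof -
  define g where "g i = (fact (m + n - d - i) :: 'a)" for i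
  define h where "h i = (fact (i - 1) / (fact (m - i) * fact (n - i)) :: 'a)" for i
  have shift: "(\<Prod>i=1..Suc e. g (Suc i)) * g 1 = (\<Prod>i=1..e. g i) * g (Suc e) * g (Suc (Suc e))" for e
  proof (induction e)
    case (Suc e)
    have "(\<Prod>i=1..Suc (Suc e). g (Suc i)) * g 1 = ((\<Prod>i=1..Suc e. g (Suc i)) * g 1) * g (Suc (Suc (Suc e)))"
      by (simp add: mult_ac)
    then show ?case
      unfolding Suc.IH by (simp add: mult_ac)
  qed simp
  have d0: "psc_const d m n = (\<Prod>i=1..d. g i) * (\<Prod>i=1..d. h i)"
    unfolding psc_const_def prod.distrib[symmetric] by (simp add: g_def h_def mult_ac)
  have "psc_const (Suc d) m n = (\<Prod>i=1..Suc d. g (Suc i)) * (\<Prod>i=1..Suc d. h i)"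
    unfolding psc_const_def prod.distrib[symmetric] by (simp add: g_def h_def mult_ac del: prod.cl_ivl_Suc)
  then have d1: "psc_const (Suc d) m n = (\<Prod>i=1..Suc d. g (Suc i)) * ((\<Prod>i=1..d. h i) * h (Suc d))"
    by simp
  have hS: "h (Suc d) = fact d / (fact (m - d - 1) * fact (n - d - 1))"
    by (simp add: h_def)
  have b1: "of_nat ((m + n - 2 * d - 2) choose (m - d - 1)) =
      g (Suc (Suc d)) / (fact (m - d - 1) * fact (n - d - 1))"
  proof -
    have "m + n - 2 * d - 2 - (m - d - 1) = n - d - 1" "m + n - 2 * d - 2 = m + n - d - Suc (Suc d)"
      "m - d - 1 \<le> m + n - 2 * d - 2"
      using d by auto
    then show ?thesis
      using d binomial_fact[of "m - d - 1" "m + n - 2 * d - 2", where ?'a = 'a]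
      by (simp add: g_def)
  qed
  have b2: "of_nat ((m + n - d - 1) choose d) = g 1 / (fact d * g (Suc d))"
  proof -
    have "m + n - d - 1 - d = m + n - d - Suc d" "d \<le> m + n - d - 1"
      using d by auto
    then show ?thesis
      using d binomial_fact[of d "m + n - d - 1", where ?'a = 'a]
      by (simp add: g_def)
  qed
  have "g (Suc d) \<noteq> 0" by (simp add: g_def)
  then show ?thesis
    using shift[of d] unfolding d0 d1 hS b1 b2
    by (simp add: divide_simps del: prod.cl_ivl_Suc)
qed

lemma det_psc_mat_linear_powers:
  fixes \<alpha> \<beta> :: "'a::field_char_0"
  assumes ne: "\<alpha> \<noteq> \<beta>" and "d \<le> min m n"
  shows "det (psc_mat d ([:- \<alpha>, 1:] ^ m) ([:- \<beta>, 1:] ^ n)) =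
         (\<alpha> - \<beta>) ^ ((m - d) * (n - d)) * psc_const d m n"
  using assms(2)
proof (induction rule: inc_induct)
  case base
  have "(m - min m n) * (n - min m n) = 0" by (auto simp: min_def)
  then show ?case
    by (subst det_psc_mat_min)
      (auto simp: psc_const_min degree_pCons_one_power coeff_pCons_one_power)
next
  case (step d)
  let ?f = "[:- \<alpha>, 1:] ^ m" and ?g = "[:- \<beta>, 1:] ^ n" and ?w = "\<alpha> - \<beta>"
  let ?b = "of_nat ((m + n - 2 * d - 2) choose (m - d - 1)) :: 'a"
  let ?c = "of_nat ((m + n - d - 1) choose d) :: 'a"
  have d: "d < min m n" and w: "?w \<noteq> 0"
    using step ne by auto
  obtain F G where FG: "F * ?f + G * ?g = jacobi_form d m n \<alpha> \<beta>" "degree F < n - d" "degree G < m - d"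
    "coeff G (m - d - 1) = (- 1) ^ (m - d - 1) * ?b / ?w ^ (m + n - d - 1)"
    by (rule jacobi_form_bezout[OF d ne])
  have deg: "degree ?f = m" "degree ?g = n" and lc: "lead_coeff ?f = 1"
    by (simp_all add: degree_pCons_one_power coeff_pCons_one_power)
  have "smult (coeff G (m - d - 1)) (subresultant d ?f ?g) =
      smult ((-1) ^ (m - d - 1) * det (psc_mat (Suc d) ?f ?g)) (jacobi_form d m n \<alpha> \<beta>)"
    using subresultant_bezout[of d ?f ?g F G, OF _ FG(1) degree_jacobi_form] d FG(2,3) lc
    unfolding deg by simp
  from arg_cong[OF this, of "\<lambda>p. coeff p d"]
  have "coeff G (m - d - 1) * det (psc_mat d ?f ?g) =
      (-1) ^ (m - d - 1) * det (psc_mat (Suc d) ?f ?g) * (?c / ?w ^ d)"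
    using d coeff_subresultant_eq_det_psc_mat[of d ?f ?g] unfolding deg
    by (simp add: coeff_jacobi_form)
  then have "?b / ?w ^ (m + n - d - 1) * det (psc_mat d ?f ?g) = det (psc_mat (Suc d) ?f ?g) * (?c / ?w ^ d)"
    unfolding FG(4) by (auto simp: minus_1_power_even split: if_splits)
  then have "?b * det (psc_mat d ?f ?g) =
      det (psc_mat (Suc d) ?f ?g) * ?c * (?w ^ (m + n - d - 1) / ?w ^ d)"
    using w by (simp add: field_simps)
  also have "?w ^ (m + n - d - 1) / ?w ^ d = ?w ^ (m + n - 2 * d - 1)"
  proof -
    have "m + n - d - 1 = (m + n - 2 * d - 1) + d" using d by auto
    then have "?w ^ (m + n - d - 1) = ?w ^ (m + n - 2 * d - 1) * ?w ^ d"
      by (metis power_add)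
    then show ?thesis using w by simp
  qed
  also have "det (psc_mat (Suc d) ?f ?g) * ?c = ?w ^ ((m - Suc d) * (n - Suc d)) * (psc_const d m n * ?b)"
    using step psc_const_Suc[OF d, where ?'a = 'a] by simp
  finally have "?b * det (psc_mat d ?f ?g) =
      ?b * (?w ^ ((m - Suc d) * (n - Suc d)) * ?w ^ (m + n - 2 * d - 1) * psc_const d m n)"
    by (simp add: mult_ac)
  \<comment> \<open>Characteristic 0 matters here: modulo a prime this binomial coefficient can
    vanish.\<close>
  moreover have "?b \<noteq> 0"
    using d by auto
  ultimately have "det (psc_mat d ?f ?g) =
      ?w ^ ((m - Suc d) * (n - Suc d)) * ?w ^ (m + n - 2 * d - 1) * psc_const d m n"
    by (metis mult_left_cancel)
  \<comment> \<open>With a = m - d - 1 and b = n - d - 1 this is ab + (a + b + 1) = (a + 1)(b + 1)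
    in the exponent.\<close>
  also have "?w ^ ((m - Suc d) * (n - Suc d)) * ?w ^ (m + n - 2 * d - 1) = ?w ^ ((m - d) * (n - d))"
  proof -
    obtain a b where "m = Suc (d + a)" "n = Suc (d + b)"
      using d by (metis less_imp_Suc_add min_less_iff_conj)
    then have "(m - Suc d) * (n - Suc d) + (m + n - 2 * d - 1) = (m - d) * (n - d)"
      by simp
    then show ?thesis by (metis power_add)
  qed
  finally show ?case .
qed

theorem subresultant_linear_powers:
  fixes \<alpha> \<beta> :: "'a::field_char_0"
  assumes ne: "\<alpha> \<noteq> \<beta>" and d: "d < min m n"
  shows "subresultant d ([:- \<alpha>, 1:] ^ m) ([:- \<beta>, 1:] ^ n) =
    smult ((\<alpha> - \<beta>) ^ ((m - d) * (n - d)) * psc_const d m n /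
           (of_nat ((m + n - d - 1) choose d) / (\<alpha> - \<beta>) ^ d)) (jacobi_form d m n \<alpha> \<beta>)"
    (is "?S = _")
proof -
  let ?f = "[:- \<alpha>, 1:] ^ m" and ?g = "[:- \<beta>, 1:] ^ n"
  let ?J = "jacobi_form d m n \<alpha> \<beta>"
  obtain F G where FG: "F * ?f + G * ?g = ?J" "degree F < n - d" "degree G < m - d"
    "coeff G (m - d - 1) = (- 1) ^ (m - d - 1) * of_nat ((m + n - 2 * d - 2) choose (m - d - 1)) / (\<alpha> - \<beta>) ^ (m + n - d - 1)"
    by (rule jacobi_form_bezout[OF d ne])
  have deg: "degree ?f = m" "degree ?g = n"
    by (simp_all add: degree_pCons_one_power)
  \<comment> \<open>Cramer's rule serves only for proportionality; the factor is then read off from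
    the coefficients of x^d.\<close>
  obtain c where c: "smult (coeff G (m - d - 1)) ?S = smult c ?J"
    using subresultant_bezout[of d ?f ?g F G, OF _ FG(1) degree_jacobi_form] d FG(2,3)
    unfolding deg by blast
  have "coeff G (m - d - 1) \<noteq> 0"
    unfolding FG(4) using ne d by auto
  then have S: "?S = smult (c / coeff G (m - d - 1)) ?J"
    using arg_cong[OF c, of "smult (1 / coeff G (m - d - 1))"] by simp
  have "coeff ?J d \<noteq> 0"
    using ne d by (auto simp: coeff_jacobi_form)
  moreover have "coeff ?S d = c / coeff G (m - d - 1) * coeff ?J d"
    by (subst S) (rule coeff_smult)
  ultimately have "c / coeff G (m - d - 1) = coeff ?S d / coeff ?J d"
    by (metis nonzero_mult_div_cancel_right)
  also have "coeff ?S d = (\<alpha> - \<beta>) ^ ((m - d) * (n - d)) * psc_const d m n"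
    using d coeff_subresultant_eq_det_psc_mat[of d ?f ?g] det_psc_mat_linear_powers[OF ne, of d m n]
    unfolding deg by simp
  also have "coeff ?J d = of_nat ((m + n - d - 1) choose d) / (\<alpha> - \<beta>) ^ d"
    using d by (rule coeff_jacobi_form)
  finally show ?thesis
    using S by simp
qed

section \<open>Integral model and specialization\<close>

lemma fract_of_nat_eq_iff:
  "(of_nat a :: 'a::{idom,ring_char_0} fract) = of_nat b \<longleftrightarrow> a = b"
  by (simp flip: to_fract_hom.hom_of_nat)

text \<open>Makes the field of \<open>ind_A\<close> and \<open>ind_B\<close> an instance of the
  results in characteristic 0.\<close>

instance fract :: ("{idom,ring_char_0}") field_char_0
  by standard (auto simp: inj_on_def fract_of_nat_eq_iff)

text \<open>A ring homomorphism from the rationals is determined by the integers: both maps solve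
  the same equation y * b = a with b nonzero.\<close>

lemma const_frac_eq_of_rat: "const_frac = of_rat"
proof
  interpret c: comm_ring_hom const_frac
    by standard (simp_all add: const_frac_def flip: to_fract_hom.hom_mult to_fract_hom.hom_add)
  fix q :: rat
  obtain a b where q: "q = of_int a / of_int b" "b > 0"
    by (metis Fract_of_int_quotient Rat_cases)
  then have "q * of_int b = of_int a" by simp
  then have "const_frac q * of_int b = of_int a"
    by (metis c.hom_mult c.hom_of_int)
  moreover have "of_rat q * (of_int b :: rat poly poly fract) = of_int a"
    using \<open>q * of_int b = of_int a\<close> by (metis of_rat_mult of_rat_of_int_eq)
  ultimately show "const_frac q = of_rat q"
    using q(2) by (metis mult_right_cancel of_int_eq_0_iff less_irrefl)
qed

lemma ind_A_neq_ind_B: "ind_A \<noteq> ind_B"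
  by (simp add: ind_A_def ind_B_def)

section \<open>The Jacobi polynomial with negative parameters\<close>

lemma pochhammer_negative_eq_binomial:
  fixes x :: "'a::field_char_0"
  assumes "x = - of_nat a"
  shows "pochhammer x k / fact k = (-1) ^ k * of_nat (a choose k)"
  using gbinomial_pochhammer[of "of_nat a :: 'a" k] assms
  by (simp add: binomial_gbinomial minus_1_power_even)

text \<open>The rising factorials start at -(n - d + j - 1) and -(m - j - 1), so each is a signed
  binomial; the signs combine to (-1)^d.\<close>

lemma jacobi_poly_negative:
  assumes d: "d < min m n"
  shows "jacobi_poly (- int n) (- int m) d = (\<Sum>j\<le>d.
    smult ((-1) ^ d * of_nat (((n - d + j - 1) choose j) * ((m - j - 1) choose (d - j))))
      ([:- 1 / 2, 1 / 2:] ^ (d - j) * [:1 / 2, 1 / 2:] ^ j))"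
  unfolding jacobi_poly_def
proof (intro sum.cong refl arg_cong2[of _ _ _ _ smult])
  fix j assume j: "j \<in> {..d}"
  have 1: "of_int (- int n + int d - int j + 1) = - (of_nat (n - d + j - 1) :: rat)"
    using d j by (simp add: of_nat_diff)
  have 2: "of_int (- int m + int j + 1) = - (of_nat (m - j - 1) :: rat)"
    using d j by (simp add: of_nat_diff)
  have "(-1 :: rat) ^ d = (-1) ^ j * (-1) ^ (d - j)"
    using j by (simp flip: power_add)
  then show "pochhammer (of_int (- int n + int d - int j + 1)) j / fact j *
        (pochhammer (of_int (- int m + int j + 1)) (d - j) / fact (d - j)) =
      ((-1) ^ d * of_nat (((n - d + j - 1) choose j) * ((m - j - 1) choose (d - j))) :: rat)"
    unfolding pochhammer_negative_eq_binomial[OF 1] pochhammer_negative_eq_binomial[OF 2] by simp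
qed

text \<open>At this argument z, (z + 1)/2 is (x - \<alpha>)/(\<beta> - \<alpha>) and (z - 1)/2 is (x
  - \<beta>)/(\<beta> - \<alpha>). The sign (-1)^d turns (\<beta> - \<alpha>)^d into (\<alpha> -
  \<beta>)^d.\<close>

lemma jacobi_poly_eq_jacobi_form:
  fixes \<alpha> \<beta> :: "'a::field_char_0"
  assumes d: "d < min m n" and ne: "\<alpha> \<noteq> \<beta>"
  shows "pcompose (map_poly of_rat (jacobi_poly (- int n) (- int m) d))
     (smult (1 / (\<beta> - \<alpha>)) ([:- \<alpha>, 1:] + [:- \<beta>, 1:])) = jacobi_form d m n \<alpha> \<beta>"
proof -
  interpret h: map_poly_comm_ring_hom "of_rat :: rat \<Rightarrow> 'a" ..
  define \<sigma> where "\<sigma> = smult (1 / (\<beta> - \<alpha>)) ([:- \<alpha>, 1:] + [:- \<beta>, 1:])"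
  obtain w where w: "\<beta> = \<alpha> + w" "w \<noteq> 0"
    using ne by (metis add.commute diff_add_cancel right_minus_eq)
  have 1: "pcompose (map_poly of_rat [:1 / 2, 1 / 2:]) \<sigma> = smult (1 / (\<beta> - \<alpha>)) [:- \<alpha>, 1:]"
    using w(2) by (simp add: w(1) poly_eq_poly_eq_iff[symmetric] fun_eq_iff poly_pcompose \<sigma>_def of_rat_divide field_simps)
  have 2: "pcompose (map_poly of_rat [:- 1 / 2, 1 / 2:]) \<sigma> = smult (1 / (\<beta> - \<alpha>)) [:- \<beta>, 1:]"
    using w(2) by (simp add: w(1) poly_eq_poly_eq_iff[symmetric] fun_eq_iff poly_pcompose \<sigma>_def of_rat_divide of_rat_minus field_simps)
  have "pcompose (map_poly of_rat (jacobi_poly (- int n) (- int m) d)) \<sigma> = (\<Sum>j\<le>d.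
    smult ((-1) ^ d * of_nat (((n - d + j - 1) choose j) * ((m - j - 1) choose (d - j))))
      (smult (1 / (\<beta> - \<alpha>)) [:- \<beta>, 1:] ^ (d - j) * smult (1 / (\<beta> - \<alpha>)) [:- \<alpha>, 1:] ^ j))"
    unfolding jacobi_poly_negative[OF d] h.hom_sum pcompose_sum of_rat_hom.map_poly_hom_smult
      h.hom_mult h.hom_power pcompose_smult pcompose_mult pcompose_hom.hom_power 1 2
    by (simp add: of_rat_mult of_rat_power of_rat_minus)
  also have "\<dots> = jacobi_form d m n \<alpha> \<beta>"
    unfolding jacobi_form_def
  proof (intro sum.cong refl)
    fix j assume j: "j \<in> {..d}"
    have "(1 / (\<beta> - \<alpha>)) ^ (d - j) * (1 / (\<beta> - \<alpha>)) ^ j = (1 / (\<beta> - \<alpha>)) ^ d"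
      using j by (simp flip: power_add)
    also have "\<dots> = (- 1) ^ d / (\<alpha> - \<beta>) ^ d"
      by (metis power_divide minus_diff_eq divide_minus_left minus_divide_right)
    finally have "(1 / (\<beta> - \<alpha>)) ^ (d - j) * (1 / (\<beta> - \<alpha>)) ^ j = (- 1) ^ d / (\<alpha> - \<beta>) ^ d" .
    then have "smult (1 / (\<beta> - \<alpha>)) [:- \<beta>, 1:] ^ (d - j) * smult (1 / (\<beta> - \<alpha>)) [:- \<alpha>, 1:] ^ j =
        smult ((- 1) ^ d / (\<alpha> - \<beta>) ^ d) ([:- \<alpha>, 1:] ^ j * [:- \<beta>, 1:] ^ (d - j))"
      by (simp only: smult_power mult_smult_left mult_smult_right smult_smult mult.commute)
    then show "smult ((-1) ^ d * of_nat (((n - d + j - 1) choose j) * ((m - j - 1) choose (d - j))))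
      (smult (1 / (\<beta> - \<alpha>)) [:- \<beta>, 1:] ^ (d - j) * smult (1 / (\<beta> - \<alpha>)) [:- \<alpha>, 1:] ^ j) =
      smult (of_nat (((n - d + j - 1) choose j) * ((m - j - 1) choose (d - j))) / (\<alpha> - \<beta>) ^ d)
        ([:- \<alpha>, 1:] ^ j * [:- \<beta>, 1:] ^ (d - j))"
      by (simp add: minus_1_power_even)
  qed
  finally show ?thesis unfolding \<sigma>_def .
qed

lemma P_poly_eq_jacobi_form:
  "d < min m n \<Longrightarrow> P_poly d m n = jacobi_form d m n ind_A ind_B"
  unfolding P_poly_def const_frac_eq_of_rat
  by (rule jacobi_poly_eq_jacobi_form[OF _ ind_A_neq_ind_B])

lemma s_coeff_eq: "s_coeff d m n = (ind_A - ind_B) ^ ((m - d) * (n - d)) * psc_const d m n"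
proof -
  have f: "of_rat (fact k) = (fact k :: 'a::field_char_0)" for k
    by (metis of_nat_fact of_rat_of_nat_eq)
  show ?thesis
    by (simp add: s_coeff_def psc_const_def const_frac_eq_of_rat of_rat_prod of_rat_divide of_rat_mult f)
qed

lemma p_coeff_eq: "p_coeff d m n = of_nat ((m + n - d - 1) choose d) / (ind_A - ind_B) ^ d"
  by (simp add: p_coeff_def)

text \<open>Preserved degrees keep the shape of the matrix and the positions of the coefficients;
  determinants commute with ring homomorphisms.\<close>

lemma (in comm_ring_hom) subresultant_map_poly:
  assumes "degree (map_poly hom f) = degree f" "degree (map_poly hom g) = degree g"
  shows "subresultant d (map_poly hom f) (map_poly hom g) = map_poly hom (subresultant d f g)"
proof -
  interpret p: map_poly_comm_ring_hom hom ..
  have "subresultant_mat d (map_poly hom f) (map_poly hom g) = map_mat (map_poly hom) (subresultant_mat d f g)"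
  proof (rule eq_matI)
    fix i j
    assume "i < dim_row (map_mat (map_poly hom) (subresultant_mat d f g))"
      "j < dim_col (map_mat (map_poly hom) (subresultant_mat d f g))"
    then have ij: "i < (degree f - d) + (degree g - d)" "j < (degree f - d) + (degree g - d)"
      by simp_all
    then show "subresultant_mat d (map_poly hom f) (map_poly hom g) $$ (i, j) =
        map_mat (map_poly hom) (subresultant_mat d f g) $$ (i, j)"
      by (auto simp: subresultant_mat_def Let_def assms coeff_int_def hom_distribs)
  qed (simp_all add: assms)
  then show ?thesis
    unfolding subresultant_def by (simp add: p.hom_det)
qed

text \<open>Powers of monic linear polynomials keep their degree under every specialization, in any
  characteristic.\<close>

lemma specialize_subresultant:
  fixes a b :: "'a::field"
  shows "specialize a b (subresultant d ([:- [:[:0, 1:]:], 1:] ^ m) ([:- [:0, 1:], 1:] ^ n)) =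
    subresultant d ([:- a, 1:] ^ m) ([:- b, 1:] ^ n)"
proof -
  interpret e: comm_ring_hom "eval2 a b" by (rule eval2_ring_hom)
  interpret m: map_poly_comm_ring_hom "eval2 a b" ..
  have lin: "map_poly (eval2 a b) [:- h, 1:] = [:- eval2 a b h, 1:]" for h
    by (simp add: e.hom_uminus map_poly_pCons)
  have map: "map_poly (eval2 a b) ([:- h, 1:] ^ k) = [:- eval2 a b h, 1:] ^ k" for h k
    by (simp only: m.hom_power lin)
  have deg: "degree (map_poly (eval2 a b) ([:- h, 1:] ^ k)) = degree ([:- h, 1:] ^ k)" for h k
    by (simp only: map degree_linear_power)
  show ?thesis
    unfolding specialize_def e.subresultant_map_poly[OF deg deg, symmetric] map eval2_generators ..
qed

text \<open>Uniqueness of the homomorphism from Z[A,B] with given images of A and B.\<close>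

lemma hom_eval2:
  assumes "comm_ring_hom \<phi>"
  shows "\<phi> (eval2 a b h) = eval2 (\<phi> a) (\<phi> b) h"
proof -
  interpret comm_ring_hom \<phi> by (rule assms)
  have inner: "\<phi> (poly (map_poly of_int p) a) = poly (map_poly of_int p) (\<phi> a)" for p :: "int poly"
    by (induction p) (simp_all add: map_poly_pCons hom_distribs)
  show ?thesis
  proof (induction h)
    case (pCons c h)
    then show ?case
      by (simp add: eval2_def map_poly_pCons inner hom_distribs)
  qed (simp add: eval2_def)
qed

text \<open>A polynomial whose coefficients depend only on \<open>c\<close> can be evaluated at
  \<open>u\<close> inside the ring generated by \<open>u\<close> and \<open>v\<close>, because
  \<open>c\<close> is itself \<open>u - v\<close>.\<close>

lemma pcompose_specialize_mem_range_eval2: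
  fixes c :: "'a::comm_ring_1"
  assumes "u - v = [:c:]"
  shows "pcompose (specialize 0 c F) u \<in> range (eval2 u v)"
proof -
  let ?e = "eval2 u v" and ?A = "[:[:0, 1:]:] :: int poly poly" and ?B = "[:0, 1:] :: int poly poly"
  interpret e: comm_ring_hom ?e by (rule eval2_ring_hom)
  \<comment> \<open>The preimage is F(0, A - B, A): \<open>?e\<close> sends A to \<open>u\<close>
    and A - B to \<open>[:c:]\<close>.\<close>
  have "?e (poly (map_poly (eval2 0 (?A - ?B)) F) ?A) = pcompose (specialize 0 c F) u"
  proof (induction F)
    case (pCons h F)
    have "?e (eval2 0 (?A - ?B) h) = eval2 0 [:c:] h"
      by (simp only: hom_eval2[OF e.comm_ring_hom_axioms] e.hom_minus e.hom_zero eval2_generators assms)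
    also have "\<dots> = [:eval2 0 c h:]"
      using hom_eval2[OF coeff_lift_hom.comm_ring_hom_axioms, of 0 c h] by simp
    finally have "?e (eval2 0 (?A - ?B) h) = [:eval2 0 c h:]" .
    moreover have z: "eval2 0 x 0 = 0" for x :: "'b::comm_ring_1"
      by (simp add: eval2_def)
    ultimately show ?case
      using pCons.IH by (simp only: specialize_def Polynomial.map_poly_pCons[where f = "eval2 0 c", OF z]
        Polynomial.map_poly_pCons[where f = "eval2 0 (?A - ?B)", OF z] poly_pCons pcompose_pCons
        e.hom_add e.hom_mult eval2_generators)
  qed (simp add: specialize_def)
  then show ?thesis
    by (metis rangeI)
qed

theorem theorem2:
  fixes d m n :: nat
  assumes "d < min m n"
  shows "P_poly d m n =
           (\<Sum>j\<le>d. smult (of_nat (((n - d + j - 1) choose j) * ((m - j - 1) choose (d - j))) /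
                            (ind_A - ind_B) ^ d)
                      ([:- ind_A, 1:] ^ j * [:- ind_B, 1:] ^ (d - j)))
       \<and> coeff (P_poly d m n) d = p_coeff d m n
       \<and> Q_poly d m n \<in> Z_x_minus_AB
       \<and> (\<exists>F. specialize ind_A ind_B F = Q_poly d m n \<and>
            (\<forall>\<alpha> \<beta> :: 'k::field. \<alpha> \<noteq> \<beta> \<longrightarrow>
               subresultant d ([:- \<alpha>, 1:] ^ m) ([:- \<beta>, 1:] ^ n) = specialize \<alpha> \<beta> F))"
proof (intro conjI exI allI impI)
  \<comment> \<open>The subresultant over Z[A,B]: a single integral witness, defined without
    reference to the field \<open>'k\<close>.\<close>
  define F :: "int poly poly poly" where
    "F = subresultant d ([:- [:[:0, 1:]:], 1:] ^ m) ([:- [:0, 1:], 1:] ^ n)"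
  note P = P_poly_eq_jacobi_form[OF assms]
  have Q: "Q_poly d m n = smult ((ind_A - ind_B) ^ ((m - d) * (n - d)) * psc_const d m n /
      (of_nat ((m + n - d - 1) choose d) / (ind_A - ind_B) ^ d)) (jacobi_form d m n ind_A ind_B)"
    by (simp only: Q_poly_def P s_coeff_eq p_coeff_eq)
  show "P_poly d m n =
      (\<Sum>j\<le>d. smult (of_nat (((n - d + j - 1) choose j) * ((m - j - 1) choose (d - j))) /
                       (ind_A - ind_B) ^ d)
                 ([:- ind_A, 1:] ^ j * [:- ind_B, 1:] ^ (d - j)))"
    unfolding P jacobi_form_def ..
  show "coeff (P_poly d m n) d = p_coeff d m n"
    unfolding P p_coeff_eq by (rule coeff_jacobi_form[OF assms])
  show "specialize ind_A ind_B F = Q_poly d m n"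
    unfolding F_def specialize_subresultant Q
    by (rule subresultant_linear_powers[OF ind_A_neq_ind_B assms])
  show "subresultant d ([:- \<alpha>, 1:] ^ m) ([:- \<beta>, 1:] ^ n) = specialize \<alpha> \<beta> F" for \<alpha> \<beta> :: 'k
    unfolding F_def specialize_subresultant ..
  show "Q_poly d m n \<in> Z_x_minus_AB"
  proof -
    let ?u = "[:- ind_A, 1:]" and ?v = "[:- ind_B, 1:]" and ?c = "ind_B - ind_A"
    \<comment> \<open>The pair \<open>0\<close>, \<open>?c\<close> has the same difference as
      \<open>ind_A\<close>, \<open>ind_B\<close>, so the scalar factor is that of
      \<open>Q_poly\<close>.\<close>
    have "0 \<noteq> ?c"
      using ind_A_neq_ind_B by simp
    from subresultant_linear_powers[OF this assms]
    have "specialize 0 ?c F = smult ((ind_A - ind_B) ^ ((m - d) * (n - d)) * psc_const d m n /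
      (of_nat ((m + n - d - 1) choose d) / (ind_A - ind_B) ^ d)) (jacobi_form d m n 0 ?c)"
      unfolding F_def specialize_subresultant by simp
    moreover have "pcompose (jacobi_form d m n 0 ?c) ?u = jacobi_form d m n ind_A ind_B"
    proof -
      have "pcompose [:- 0, 1:] ?u = ?u" "pcompose [:- ?c, 1:] ?u = ?v"
        by (simp_all add: pcompose_pCons)
      moreover have "0 - ?c = ind_A - ind_B" by simp
      ultimately show ?thesis
        unfolding jacobi_form_def
        by (simp only: pcompose_sum pcompose_smult pcompose_mult pcompose_hom.hom_power)
    qed
    ultimately have "Q_poly d m n = pcompose (specialize 0 ?c F) ?u"
      by (simp only: Q pcompose_smult)
    also have "\<dots> \<in> range (eval2 ?u ?v)"
      by (rule pcompose_specialize_mem_range_eval2) simp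
    finally show ?thesis unfolding Z_x_minus_AB_def .
  qed
qed

end
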